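(* Let $p,q\ge0$ with $m=p+q\ge1$, and let $v_1,\ldots,v_n\in\mathbb{C}^d$ be vectors, not all zero. Then $$\sum_{j=1}^n\sum_{k=1}^n\langle v_j,v_k\rangle^p\overline{\langle v_j,v_k\rangle}^q\ \ge\ b_{p,q}(\mathbb{C}^d)\Bigl(\sum_{\ell=1}^n\|v_\ell\|^{p+q}\Bigr)^2,$$ with equality if and only if $(v_j)$ is an $m$-weighted spherical design for $\operatorname{Hom}_{p,q}(\mathbb{C}^d)$, and $$\sum_{j=1}^n\sum_{k=1}^n(\operatorname{Re}\langle v_j,v_k\rangle)^m\ \ge\ b_m(\mathbb{R}^{2d})\Bigl(\sum_{\ell=1}^n\|v_\ell\|^m\Bigr)^2,$$ with equality if and only if $(v_j)$ is an $m$-weighted spherical half-design of order $m$.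
   Context: $\langle z,w\rangle=\sum_iz_i\overline{w_i}$; $\sigma$ is normalised surface measure on the unit sphere $\mathbb{S}$ of $\mathbb{C}^d$. "$(v_j)$ is an $m$-weighted design for $P$" means $\int_{\mathbb{S}}f\,d\sigma=\sum_jw_jf(v_j/\|v_j\|)$ for all $f\in P$, where $w_j=\|v_j\|^m/\sum_\ell\|v_\ell\|^m$ (zero vectors get weight $0$). $\operatorname{Hom}_{p,q}(\mathbb{C}^d)$: polynomials homogeneous of degree $p$ in $z$ and degree $q$ in $\overline z$. A half-design of order $m$ is a design for $\operatorname{Hom}_m(\mathbb{C}^d)$, the homogeneous polynomials of degree $m$ in the real coordinates of $\mathbb{C}^d=\mathbb{R}^{2d}$. $b_{p,q}(\mathbb{C}^d)$ is $0$ if $p\ne q$ and $\frac{(d-1)!p!}{(d-1+p)!}$ if $p=q$; $b_m(\mathbb{R}^{2d})$ is $0$ for $m$ odd and $\frac{1\cdot3\cdots(m-1)}{2d(2d+2)\cdots(2d+m-2)}$ for $m$ even. *)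

theory Defs
  imports "HOL-Analysis.Analysis"
begin

definition cinner :: "complex^'d \<Rightarrow> complex^'d \<Rightarrow> complex" where
  "cinner z w = (\<Sum>i\<in>UNIV. z$i * cnj (w$i))"

text \<open>Normalised surface measure on the unit sphere of C^d = R^(2d): the cone measure,
  i.e. the push-forward of normalised Lebesgue measure on the unit ball under x / norm x.\<close>
definition sphere_measure :: "(complex^'d) measure" where
  "sphere_measure = distr (uniform_measure lborel (ball 0 1)) borel (\<lambda>x. x /\<^sub>R norm x)"

definition hom_pq :: "nat \<Rightarrow> nat \<Rightarrow> ((complex^'d) \<Rightarrow> complex) set" where
  "hom_pq p q = {f. \<exists>c :: ('d \<Rightarrow> nat) \<Rightarrow> ('d \<Rightarrow> nat) \<Rightarrow> complex.
      f = (\<lambda>z. \<Sum>(a, b)\<in>{(a, b). sum a UNIV = p \<and> sum b UNIV = q}.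
              c a b * (\<Prod>i\<in>UNIV. (z$i) ^ a i * (cnj (z$i)) ^ b i))}"

definition hom_real :: "nat \<Rightarrow> ((complex^'d) \<Rightarrow> real) set" where
  "hom_real m = {f. \<exists>c :: ('d \<Rightarrow> nat) \<Rightarrow> ('d \<Rightarrow> nat) \<Rightarrow> real.
      f = (\<lambda>z. \<Sum>(a, b)\<in>{(a, b). sum a UNIV + sum b UNIV = m}.
              c a b * (\<Prod>i\<in>UNIV. (Re (z$i)) ^ a i * (Im (z$i)) ^ b i))}"

definition weighted_design ::
  "nat \<Rightarrow> nat \<Rightarrow> (nat \<Rightarrow> complex^'d) \<Rightarrow> ((complex^'d) \<Rightarrow> 'b::{banach,second_countable_topology}) set \<Rightarrow> bool" where
  "weighted_design m n v P \<longleftrightarrow>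
     (\<forall>f\<in>P. integral\<^sup>L sphere_measure f =
        (\<Sum>j<n. (norm (v j) ^ m / (\<Sum>l<n. norm (v l) ^ m)) *\<^sub>R f (v j /\<^sub>R norm (v j))))"

definition b_pq :: "nat \<Rightarrow> nat \<Rightarrow> nat \<Rightarrow> real" where
  "b_pq d p q = (if p \<noteq> q then 0 else fact (d - 1) * fact p / fact (d - 1 + p))"

definition b_real :: "nat \<Rightarrow> nat \<Rightarrow> real" where
  "b_real D m = (if odd m then 0 else
     (\<Prod>i<m div 2. real (2 * i + 1)) / (\<Prod>i<m div 2. real D + 2 * real i))"

end

theory Submission
  imports Defs "HOL-Probability.Probability_Measure"
begin

text \<open>
  The kernels \<open>Re (\<langle>x,y\<rangle>\<^sup>p cnj \<langle>x,y\<rangle>\<^sup>q)\<close> and \<open>(Re \<langle>x,y\<rangle>)\<^sup>m\<close> have the form \<open>\<Sum>\<^sub>i \<phi>\<^sub>i x \<bullet> \<phi>\<^sub>i y\<close>,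
  where the \<open>\<phi>\<^sub>i\<close> are monomials spanning \<open>Hom\<^sub>p\<^sub>,\<^sub>q\<close> and \<open>Hom\<^sub>m\<close>. Rotation invariance of \<open>\<sigma>\<close> gives
  \<open>\<integral> K(x,y) d\<sigma>(y) = b \<parallel>x\<parallel>\<^sup>m\<close>, so with \<open>W = \<Sum>\<^sub>l \<parallel>v\<^sub>l\<parallel>\<^sup>m\<close> the difference
  \<open>\<Sum>\<^sub>j\<^sub>k K(v\<^sub>j,v\<^sub>k) - b W\<^sup>2\<close> equals \<open>\<Sum>\<^sub>i \<parallel>\<Sum>\<^sub>j \<phi>\<^sub>i(v\<^sub>j) - W \<integral> \<phi>\<^sub>i d\<sigma>\<parallel>\<^sup>2\<close>. It is nonnegative, and
  vanishes exactly when every \<open>\<phi>\<^sub>i\<close> is integrated correctly.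
\<close>

subsection \<open>Rotation invariance of the sphere measure\<close>

text \<open>Lebesgue measure is determined by its values on boxes. Since \<open>h\<close> enumerates
  the basis, the preimage of a box is the box with the same side lengths, so both measures give it
  the same product.\<close>

lemma distr_lborel_coordinates:
  fixes h :: "'n::finite \<Rightarrow> 'a::euclidean_space"
  assumes h: "bij_betw h UNIV Basis"
  shows "distr lborel borel (\<lambda>x. \<chi> i. x \<bullet> h i) = (lborel :: (real^'n) measure)"
proof (rule sym, rule lborel_eqI)
  let ?F = "\<lambda>x::'a. \<chi> i. x \<bullet> h i"
  let ?G = "\<lambda>y::real^'n. \<Sum>b\<in>Basis. (y $ inv h b) *\<^sub>R b"
  have inj: "inj h" and ran: "range h = Basis"
    using h by (auto simp: bij_betw_def)
  have hB: "h i \<in> Basis" for i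
    using ran by auto
  have Gh: "?G y \<bullet> h i = y $ i" for y i
    using hB[of i] inj by (simp add: inner_sum_left inner_Basis if_distrib cong: if_cong)
  have meas: "?F \<in> borel_measurable borel"
    by (intro borel_measurable_continuous_onI continuous_intros)
  fix l u :: "real^'n"
  assume le: "\<And>b. b \<in> Basis \<Longrightarrow> l \<bullet> b \<le> u \<bullet> b"
  have le': "l $ i \<le> u $ i" for i
    using le[of "axis i 1"] by (auto simp: Basis_vec_def inner_axis)
  have "?F -` box l u = box (?G l) (?G u)"
  proof (rule set_eqI)
    fix x
    have "x \<in> box (?G l) (?G u) \<longleftrightarrow> (\<forall>i. ?G l \<bullet> h i < x \<bullet> h i \<and> x \<bullet> h i < ?G u \<bullet> h i)"
      unfolding mem_box ran[symmetric] by blast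
    also have "\<dots> \<longleftrightarrow> x \<in> ?F -` box l u"
      by (simp add: Gh mem_box_cart)
    finally show "x \<in> ?F -` box l u \<longleftrightarrow> x \<in> box (?G l) (?G u)"
      by simp
  qed
  moreover have "\<forall>b\<in>Basis. ?G l \<bullet> b \<le> ?G u \<bullet> b"
  proof
    fix b :: 'a assume "b \<in> Basis"
    then obtain i where "b = h i" using ran by blast
    then show "?G l \<bullet> b \<le> ?G u \<bullet> b" using Gh le' by simp
  qed
  moreover have "(\<Prod>b\<in>Basis. (?G u - ?G l) \<bullet> b) = (\<Prod>i\<in>UNIV. (u - l) $ i)"
    unfolding ran[symmetric] prod.reindex[OF inj] o_def inner_diff_left
    unfolding ran Gh by simp
  moreover have "(\<Prod>b\<in>Basis. (u - l) \<bullet> b) = (\<Prod>i\<in>UNIV. (u - l) $ i)"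
    by (simp add: Basis_vec_def prod.UNION_disjoint UNION_singleton_eq_range
        prod.reindex axis_eq_axis inj_on_def inner_axis)
  ultimately show "emeasure (distr lborel borel ?F) (box l u) = (\<Prod>b\<in>Basis. (u - l) \<bullet> b)"
    using meas by (simp add: emeasure_distr emeasure_lborel_box_eq)
qed simp

text \<open>It suffices to test boxes. The preimage of a box under \<open>T\<close> is its image
  under the orthogonal map \<open>inv T\<close>, and orthogonal images preserve Lebesgue
  measure.\<close>

lemma distr_lborel_orthogonal_cart:
  fixes T :: "real^'n::{finite,wellorder} \<Rightarrow> real^'n::_"
  assumes T: "orthogonal_transformation T"
  shows "distr lborel borel T = lborel"
proof (rule sym, rule lborel_eqI)
  have meas: "T \<in> borel_measurable borel"
    using T by (intro borel_measurable_continuous_onI linear_continuous_on)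
      (simp add: orthogonal_transformation_linear linear_conv_bounded_linear[symmetric])
  fix l u :: "real^'n::_"
  assume le: "\<And>b. b \<in> Basis \<Longrightarrow> l \<bullet> b \<le> u \<bullet> b"
  have T': "orthogonal_transformation (inv T)"
    by (rule orthogonal_transformation_inv[OF T])
  have pre: "T -` box l u = inv T ` box l u"
    using bij_vimage_eq_inv_image[OF orthogonal_transformation_bij[OF T]] .
  have lm: "inv T ` box l u \<in> lmeasurable"
    by (rule measurable_orthogonal_image[OF T']) simp
  have bor: "T -` box l u \<in> sets borel"
    using measurable_sets[OF meas, of "box l u"] by simp
  \<comment> \<open>The invariance of volume concerns the completed measure; the two measures agree
    here because the preimage is Borel.\<close>
  have "emeasure lborel (T -` box l u) = emeasure lebesgue (inv T ` box l u)"
    using bor by (simp add: pre)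
  also have "\<dots> = measure lebesgue (inv T ` box l u)"
    using lm by (simp add: emeasure_eq_measure2)
  also have "\<dots> = measure lebesgue (box l u)"
    by (subst measure_orthogonal_image[OF T']) auto
  also have "\<dots> = (\<Prod>b\<in>Basis. (u - l) \<bullet> b)"
    using le by (simp add: measure_lborel_box_eq)
  finally show "emeasure (distr lborel borel T) (box l u) = (\<Prod>b\<in>Basis. (u - l) \<bullet> b)"
    using meas by (simp add: emeasure_distr)
qed simp

text \<open>Conjugation by the coordinate isometry \<open>?F\<close>, with inverse
  \<open>?G\<close>, turns \<open>T\<close> into the orthogonal map \<open>?T\<close> of
  \<open>real^'n\<close>. Both \<open>?G\<close> and \<open>?T\<close> carry Lebesgue measure to
  Lebesgue measure, and \<open>T\<close> after \<open>?G\<close> equals \<open>?G\<close> after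
  \<open>?T\<close>.\<close>

lemma distr_lborel_orthogonal:
  fixes T :: "'a::euclidean_space \<Rightarrow> 'a" and h :: "'n::{finite,wellorder} \<Rightarrow> 'a"
  assumes h: "bij_betw h UNIV Basis" and T: "orthogonal_transformation T"
  shows "distr lborel borel T = lborel"
proof -
  let ?F = "\<lambda>x::'a. (\<chi> i. x \<bullet> h i) :: real^'n::_"
  let ?G = "\<lambda>y::real^'n::_. \<Sum>i\<in>UNIV. (y $ i) *\<^sub>R h i"
  let ?T = "\<lambda>y. ?F (T (?G y))"
  have inj: "inj h" and ran: "range h = Basis"
    using h by (auto simp: bij_betw_def)
  have inner_h: "x \<bullet> y = (\<Sum>i\<in>UNIV. (x \<bullet> h i) * (y \<bullet> h i))" for x y :: 'a
    by (subst euclidean_inner) (simp add: ran[symmetric] sum.reindex[OF inj])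
  have GF: "?G (?F x) = x" for x
    using euclidean_representation[of x] by (simp add: ran[symmetric] sum.reindex[OF inj])
  have Fin: "?F x \<bullet> ?F y = x \<bullet> y" for x y
    unfolding inner_h[of x y] by (simp add: inner_vec_def)
  have hij: "h i \<bullet> h j = (if i = j then 1 else 0)" for i j
    using bij_betw_apply[OF h, of i] bij_betw_apply[OF h, of j] inj
    by (simp add: inner_Basis inj_eq)
  have FG: "?F (?G y) = y" for y
    by (simp add: hij vec_eq_iff inner_sum_left if_distrib cong: if_cong)
  have Gin: "?G x \<bullet> ?G y = x \<bullet> y" for x y
    by (metis Fin FG)
  have linT: "linear T" by (rule orthogonal_transformation_linear[OF T])
  have linF: "linear ?F" by (rule linearI) (auto simp: vec_eq_iff inner_left_distrib)
  have linG: "linear ?G"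
    by (rule linearI) (auto simp: scaleR_left_distrib sum.distrib scaleR_sum_right)
  have "linear ?T"
    using linear_compose[OF linear_compose[OF linG linT] linF] by (simp add: o_def)
  then have orth: "orthogonal_transformation ?T"
    using T by (simp add: orthogonal_transformation_def Fin Gin)
  have mT [measurable]: "T \<in> borel_measurable borel"
    using linT by (intro borel_measurable_continuous_onI linear_continuous_on)
      (simp add: linear_conv_bounded_linear[symmetric])
  have mF [measurable]: "?F \<in> borel_measurable borel"
    using linF by (intro borel_measurable_continuous_onI linear_continuous_on)
      (simp add: linear_conv_bounded_linear[symmetric])
  have mG [measurable]: "?G \<in> borel_measurable borel"
    using linG by (intro borel_measurable_continuous_onI linear_continuous_on)
      (simp add: linear_conv_bounded_linear[symmetric])
  have lborel_G: "distr lborel borel ?G = (lborel :: 'a measure)"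
  proof -
    have "distr lborel borel ?G = distr (distr lborel borel ?F) borel ?G"
      by (simp only: distr_lborel_coordinates[OF h])
    also have "\<dots> = distr lborel borel (\<lambda>x. ?G (?F x))"
      by (subst distr_distr) (auto simp: o_def)
    also have "\<dots> = distr lborel borel (\<lambda>x. x)"
      by (simp only: GF)
    also have "\<dots> = lborel" by (rule distr_id2) simp
    finally show ?thesis .
  qed
  have "distr (lborel :: 'a measure) borel T = distr (distr lborel borel ?G) borel T"
    by (simp only: lborel_G)
  also have "\<dots> = distr lborel borel (\<lambda>x. T (?G x))"
    by (subst distr_distr) (auto simp: o_def)
  also have "\<dots> = distr lborel borel (\<lambda>x. ?G (?T x))"
    by (simp only: GF)
  also have "\<dots> = distr (distr lborel borel ?T) borel ?G"
    by (subst distr_distr) (auto simp: o_def)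
  also have "\<dots> = lborel"
    by (simp only: distr_lborel_orthogonal_cart[OF orth] lborel_G)
  finally show ?thesis .
qed

text \<open>Indexing the \<open>2d\<close> real directions by \<open>'d \<times> bool\<close> lets a
  word over this alphabet stand for a monomial in real and imaginary parts.\<close>

definition real_axis :: "'d::finite \<times> bool \<Rightarrow> complex^'d" where
  "real_axis = (\<lambda>(i, b). axis i (if b then 1 else \<i>))"

lemma bij_betw_real_axis: "bij_betw real_axis UNIV (Basis :: (complex^'d::finite) set)"
proof (rule bij_betw_imageI)
  show "inj (real_axis :: 'd \<times> bool \<Rightarrow> _)"
    by (auto simp: inj_on_def real_axis_def axis_eq_axis split: if_splits)
  show "range real_axis = (Basis :: (complex^'d) set)"
    by (auto simp: real_axis_def Basis_vec_def Basis_complex_def image_iff)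
      (metis, metis)
qed

text \<open>The library proves invariance of Lebesgue measure under linear maps only for
  \<open>real ^ 'n\<close> with \<open>'n\<close> well-ordered; \<open>'d bit0\<close> is a well-ordered type with
  \<open>2 * CARD('d)\<close> elements.\<close>

lemma distr_lborel_orthogonal_complex:
  fixes T :: "complex^'d::finite \<Rightarrow> complex^'d"
  assumes T: "orthogonal_transformation T"
  shows "distr lborel borel T = lborel"
proof -
  have "CARD('d bit0) = card (Basis :: (complex^'d) set)" by simp
  then obtain h :: "'d bit0 \<Rightarrow> complex^'d" where "bij_betw h UNIV Basis"
    by (metis finite_Basis finite_UNIV finite_same_card_bij finite)
  then show ?thesis
    by (rule distr_lborel_orthogonal[OF _ T])
qed

lemma inner_real_axis: "z \<bullet> real_axis (i, b) = (if b then Re (z $ i) else Im (z $ i))"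
  by (simp add: real_axis_def inner_axis)

text \<open>These properties of the surface measure suffice for all real moments. The measure lives
  on the whole space, so being carried by the unit sphere is an almost-everywhere statement.\<close>

locale rotation_invariant = prob_space M for M :: "'a::euclidean_space measure" +
  assumes sets_M [measurable_cong, simp]: "sets M = sets borel"
    and AE_norm: "AE x in M. norm x = 1"
    and rotate: "orthogonal_transformation T \<Longrightarrow> distr M borel T = M"

text \<open>Orthogonal maps preserve norms, so the unit ball is its own preimage and conditioning on
  it keeps the invariance.\<close>

lemma distr_uniform_ball_orthogonal:
  fixes T :: "'a::euclidean_space \<Rightarrow> 'a"
  assumes T: "orthogonal_transformation T" and inv: "distr lborel borel T = lborel"
  shows "distr (uniform_measure lborel (ball 0 1)) borel T = uniform_measure lborel (ball 0 1)"
proof (rule measure_eqI)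
  have mT [measurable]: "T \<in> borel_measurable borel"
    using T by (intro borel_measurable_continuous_onI linear_continuous_on)
      (simp add: orthogonal_transformation_linear linear_conv_bounded_linear[symmetric])
  fix X :: "'a set"
  assume "X \<in> sets (distr (uniform_measure lborel (ball 0 1)) borel T)"
  then have X [measurable]: "X \<in> sets borel" by simp
  have TX: "T -` X \<in> sets borel"
    using measurable_sets[OF mT X] by simp
  have "ball 0 1 \<inter> T -` X = T -` (ball 0 1 \<inter> X)"
    using orthogonal_transformation_norm[OF T] by auto
  then have "emeasure lborel (ball 0 1 \<inter> T -` X) = emeasure (distr lborel borel T) (ball 0 1 \<inter> X)"
    by (simp add: emeasure_distr)
  then show "emeasure (distr (uniform_measure lborel (ball 0 1)) borel T) X
      = emeasure (uniform_measure lborel (ball 0 1)) X"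
    using TX by (simp add: emeasure_distr inv)
qed simp

text \<open>The radial projection \<open>?N\<close> commutes with every orthogonal map, so the
  push-forward inherits the invariance of the uniform measure on the ball.\<close>

lemma rotation_invariant_sphere_measure:
  "rotation_invariant (sphere_measure :: (complex^'d::finite) measure)"
proof -
  let ?U = "uniform_measure lborel (ball 0 1) :: (complex^'d) measure"
  let ?N = "\<lambda>x::complex^'d. x /\<^sub>R norm x"
  have N [measurable]: "?N \<in> borel_measurable borel"
    by measurable
  have "emeasure lborel (ball (0::complex^'d) 1) > 0"
    using open_not_negligible[of "ball (0::complex^'d) 1"] 
    by (auto simp: zero_less_iff_neq_zero negligible_iff_null_sets null_sets_def)
  moreover have "emeasure lborel (ball (0::complex^'d) 1) < \<infinity>"
    by (rule emeasure_bounded_finite) simp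
  ultimately have fin: "emeasure lborel (ball (0::complex^'d) 1) \<noteq> 0"
      "emeasure lborel (ball (0::complex^'d) 1) \<noteq> \<infinity>" by auto
  interpret U: prob_space ?U
    by (rule prob_space_uniform_measure[OF fin])
  have mN: "?N \<in> measurable ?U borel" by simp
  have "prob_space (sphere_measure :: (complex^'d) measure)"
    unfolding sphere_measure_def by (rule U.prob_space_distr) simp
  moreover have "AE x in (sphere_measure :: (complex^'d) measure). norm x = 1"
  proof -
    \<comment> \<open>\<open>?N x\<close> has norm 1 except at the origin, which is a null
      set.\<close>
    have "AE x in lborel. x \<noteq> (0::complex^'d)"
      by (rule AE_lborel_singleton)
    then have "AE x in ?U. norm (?N x) = 1"
      by (intro AE_uniform_measureI) auto
    then show ?thesis
      unfolding sphere_measure_def by (subst AE_distr_iff[OF mN]) auto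
  qed
  moreover have "distr sphere_measure borel T = sphere_measure"
    if T: "orthogonal_transformation T" for T :: "complex^'d \<Rightarrow> complex^'d"
  proof -
    have mT [measurable]: "T \<in> borel_measurable borel"
      using T by (intro borel_measurable_continuous_onI linear_continuous_on)
        (simp add: orthogonal_transformation_linear linear_conv_bounded_linear[symmetric])
    have comm: "T (?N x) = ?N (T x)" for x
      using T by (simp add: orthogonal_transformation_norm orthogonal_transformation_scaleR)
    have "distr sphere_measure borel T = distr ?U borel (\<lambda>x. T (?N x))"
      unfolding sphere_measure_def by (subst distr_distr) (auto simp: o_def)
    also have "\<dots> = distr ?U borel (\<lambda>x. ?N (T x))"
      by (simp only: comm)
    also have "\<dots> = distr (distr ?U borel T) borel ?N"
      by (subst distr_distr) (auto simp: o_def)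
    also have "\<dots> = sphere_measure"
      unfolding sphere_measure_def
      by (simp only: distr_uniform_ball_orthogonal[OF T distr_lborel_orthogonal_complex[OF T]])
    finally show ?thesis .
  qed
  ultimately show ?thesis
    by (simp add: rotation_invariant_def rotation_invariant_axioms_def)
      (simp add: sphere_measure_def)
qed

subsection \<open>Moments of rotation-invariant measures\<close>

text \<open>For distinct vectors of equal norm, the reflection in the hyperplane orthogonal to
  \<open>a - b\<close> exchanges them.\<close>

lemma orthogonal_transformation_reflection_exists:
  fixes a b :: "'a::euclidean_space"
  assumes "norm a = norm b"
  obtains T where "orthogonal_transformation T" "T a = b"
proof (cases "a = b")
  case True
  then show ?thesis using that[of "\<lambda>x. x"] by simp
next
  case False
  define u where "u = a - b"
  define T where "T x = x - (2 * (x \<bullet> u) / (u \<bullet> u)) *\<^sub>R u" for x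
  have uu: "u \<bullet> u \<noteq> 0" using False by (simp add: u_def)
  have "a \<bullet> a = b \<bullet> b" using assms by (simp add: norm_eq)
  \<comment> \<open>This makes the reflection coefficient at \<open>a\<close> equal to 1, whence
    \<open>T a = a - u = b\<close>.\<close>
  then have au: "2 * (a \<bullet> u) = u \<bullet> u"
    by (simp add: u_def inner_diff inner_commute algebra_simps)
  have "linear T"
    unfolding T_def
    by (rule linearI) (auto simp: inner_left_distrib algebra_simps add_divide_distrib scaleR_add_left)
  moreover have "T x \<bullet> T y = x \<bullet> y" for x y
  proof -
    have "(2 * (x \<bullet> u) / (u \<bullet> u)) * ((2 * (y \<bullet> u) / (u \<bullet> u)) * (u \<bullet> u))
        = (2 * (x \<bullet> u) / (u \<bullet> u)) * (2 * (y \<bullet> u))"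
      using uu by simp
    then show ?thesis
      unfolding T_def inner_diff_left inner_diff_right inner_scaleR_left inner_scaleR_right
        inner_commute[of u y]
      by (simp add: field_simps)
  qed
  moreover have "T a = b"
    using uu unfolding T_def au by (simp add: u_def)
  ultimately show ?thesis
    using that by (auto simp: orthogonal_transformation_def)
qed

text \<open>Polynomials that agree for all \<open>t\<close> have equal coefficients. The exponent
  \<open>Suc k\<close> keeps the degree at least 2, so that the index 2 is in range.\<close>

lemma even_binomial_polynomial_coeff:
  fixes c :: real and M :: "nat \<Rightarrow> real"
  assumes eq: "\<And>t. (\<Sum>j\<le>2 * Suc k. M j * t ^ j) = c * (1 + t\<^sup>2) ^ Suc k"
  shows "M 2 = c * real (Suc k)"
proof -
  define d where "d j = (if even j then c * real (Suc k choose (j div 2)) else 0)" for j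
  have "c * (1 + t\<^sup>2) ^ Suc k = (\<Sum>j\<le>2 * Suc k. d j * t ^ j)" for t
  proof -
    have "c * (1 + t\<^sup>2) ^ Suc k = (\<Sum>i\<le>Suc k. c * real (Suc k choose i) * (t\<^sup>2) ^ i)"
      using binomial_ring[of "t\<^sup>2" 1 "Suc k"]
      by (simp add: add.commute sum_distrib_left mult.assoc del: sum.atMost_Suc binomial_Suc_Suc power_Suc)
    also have "\<dots> = (\<Sum>i\<le>Suc k. d (2 * i) * t ^ (2 * i))"
      by (simp add: d_def power_mult del: sum.atMost_Suc)
    also have "\<dots> = (\<Sum>j\<in>(\<lambda>i. 2 * i) ` {..Suc k}. d j * t ^ j)"
      by (subst sum.reindex) (auto simp: inj_on_def simp del: sum.atMost_Suc)
    also have "\<dots> = (\<Sum>j\<le>2 * Suc k. d j * t ^ j)"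
    proof (rule sum.mono_neutral_left)
      show "\<forall>j\<in>{..2 * Suc k} - (\<lambda>i. 2 * i) ` {..Suc k}. d j * t ^ j = 0"
      proof
        fix j assume "j \<in> {..2 * Suc k} - (\<lambda>i. 2 * i) ` {..Suc k}"
        then have "odd j" by (auto elim!: evenE)
        then show "d j * t ^ j = 0" by (simp add: d_def)
      qed
    qed auto
    finally show ?thesis .
  qed
  then have "\<forall>t. (\<Sum>j\<le>2 * Suc k. M j * t ^ j) = (\<Sum>j\<le>2 * Suc k. d j * t ^ j)"
    using eq by metis
  then have "M 2 = d 2"
    unfolding polyfun_eq_coeffs by simp
  then show ?thesis by (simp add: d_def)
qed

context rotation_invariant
begin

lemma measurable_orthogonal:
  assumes T: "orthogonal_transformation T"
  shows "T \<in> borel_measurable M"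
proof -
  have "T \<in> borel_measurable borel"
    using T by (intro borel_measurable_continuous_onI linear_continuous_on)
      (simp add: orthogonal_transformation_linear linear_conv_bounded_linear[symmetric])
  then show ?thesis by simp
qed

text \<open>Almost every point lies in the compact unit ball, where a continuous function is
  bounded, and the total mass is finite.\<close>

lemma integrable_continuous:
  fixes f :: "'a \<Rightarrow> 'b::{banach,second_countable_topology}"
  assumes f: "continuous_on UNIV f"
  shows "integrable M f"
proof -
  have "compact (f ` cball 0 1)"
    using continuous_on_subset[OF f] by (intro compact_continuous_image) auto
  then have "bounded (f ` cball 0 1)" by (rule compact_imp_bounded)
  then obtain B where "\<forall>x\<in>cball 0 1. norm (f x) \<le> B"
    unfolding bounded_iff by blast
  then have "AE x in M. norm (f x) \<le> B"
    using AE_norm by (auto simp: dist_norm elim!: eventually_mono)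
  moreover have "f \<in> borel_measurable M"
    using borel_measurable_continuous_onI[OF f] by simp
  ultimately show ?thesis
    by (rule integrable_const_bound)
qed

lemma integral_rotate:
  fixes f :: "'a \<Rightarrow> 'b::{banach,second_countable_topology}"
  assumes f: "continuous_on UNIV f" and T: "orthogonal_transformation T"
  shows "(\<integral>x. f (T x) \<partial>M) = (\<integral>x. f x \<partial>M)"
  using integral_distr[OF measurable_orthogonal[OF T] borel_measurable_continuous_onI[OF f]]
  by (simp add: rotate[OF T])

text \<open>With an orthogonal \<open>T\<close> taking \<open>a\<close> to \<open>b\<close>, one has
  \<open>b \<bullet> T y = T a \<bullet> T y = a \<bullet> y\<close>, and the integral is unchanged
  when \<open>y\<close> is rotated.\<close>

lemma integral_inner_cong_norm:
  fixes g :: "real \<Rightarrow> real"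
  assumes g: "continuous_on UNIV g" and "norm a = norm b"
  shows "(\<integral>y. g (a \<bullet> y) \<partial>M) = (\<integral>y. g (b \<bullet> y) \<partial>M)"
proof -
  obtain T where T: "orthogonal_transformation T" "T a = b"
    using orthogonal_transformation_reflection_exists[OF assms(2)] .
  have "continuous_on UNIV (\<lambda>y. g (b \<bullet> y))"
    by (intro continuous_on_compose2[OF g] continuous_intros) auto
  from integral_rotate[OF this T(1)] show ?thesis
    using T by (auto simp: orthogonal_transformation_def)
qed

lemma integral_inner_power_odd:
  assumes "odd m"
  shows "(\<integral>y. (x \<bullet> y) ^ m \<partial>M) = 0"
proof -
  have "(\<integral>y. (x \<bullet> y) ^ m \<partial>M) = (\<integral>y. (- x \<bullet> y) ^ m \<partial>M)"
    by (intro integral_inner_cong_norm continuous_intros) simp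
  also have "\<dots> = - (\<integral>y. (x \<bullet> y) ^ m \<partial>M)"
    using assms by simp
  finally show ?thesis by simp
qed

lemma integral_inner_power_scale:
  assumes "norm e = 1"
  shows "(\<integral>y. (x \<bullet> y) ^ m \<partial>M) = norm x ^ m * (\<integral>y. (e \<bullet> y) ^ m \<partial>M)"
proof -
  have "(\<integral>y. (x \<bullet> y) ^ m \<partial>M) = (\<integral>y. ((norm x *\<^sub>R e) \<bullet> y) ^ m \<partial>M)"
    using assms by (intro integral_inner_cong_norm continuous_intros) simp
  also have "\<dots> = norm x ^ m * (\<integral>y. (e \<bullet> y) ^ m \<partial>M)"
    by (simp add: power_mult_distrib)
  finally show ?thesis .
qed

text \<open>Compare the coefficients of \<open>t\<^sup>2\<close> in
  \<open>\<integral> ((e + t f) \<bullet> y)\<^sup>2\<^sup>k\<^sup>+\<^sup>2 = c (1 + t\<^sup>2)\<^sup>k\<^sup>+\<^sup>1\<close>.\<close>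

lemma integral_inner_mixed_power:
  assumes e: "norm e = 1" and f: "norm f = 1" and ef: "e \<bullet> f = 0"
  shows "real (2 * k + 1) * (\<integral>y. (e \<bullet> y) ^ (2 * k) * (f \<bullet> y)\<^sup>2 \<partial>M)
    = (\<integral>y. (e \<bullet> y) ^ (2 * Suc k) \<partial>M)"
proof -
  define c where "c = (\<integral>y. (e \<bullet> y) ^ (2 * Suc k) \<partial>M)"
  define I where "I j = (\<integral>y. (f \<bullet> y) ^ j * (e \<bullet> y) ^ (2 * Suc k - j) \<partial>M)" for j
  have int [simp]: "integrable M (\<lambda>y. (f \<bullet> y) ^ j * (e \<bullet> y) ^ i)" for i j
    by (intro integrable_continuous continuous_intros)
  have "(\<Sum>j\<le>2 * Suc k. (real (2 * Suc k choose j) * I j) * t ^ j) = c * (1 + t\<^sup>2) ^ Suc k" for t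
  proof -
    have "norm (e + t *\<^sub>R f) ^ 2 = 1 + t\<^sup>2"
      using e f ef unfolding norm_eq_1 power2_norm_eq_inner
      by (simp add: inner_add inner_commute power2_eq_square)
    then have "c * (1 + t\<^sup>2) ^ Suc k = norm (e + t *\<^sub>R f) ^ (2 * Suc k) * c"
      by (simp only: power_mult) (rule mult.commute)
    also have "\<dots> = (\<integral>y. ((e + t *\<^sub>R f) \<bullet> y) ^ (2 * Suc k) \<partial>M)"
      unfolding c_def by (rule integral_inner_power_scale[OF e, symmetric])
    also have "\<dots> = (\<integral>y. (\<Sum>j\<le>2 * Suc k. (real (2 * Suc k choose j) * t ^ j) *
        ((f \<bullet> y) ^ j * (e \<bullet> y) ^ (2 * Suc k - j))) \<partial>M)"
    proof (rule Bochner_Integration.integral_cong[OF refl])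
      fix y
      have "(e + t *\<^sub>R f) \<bullet> y = t * (f \<bullet> y) + e \<bullet> y"
        by (simp add: inner_add_left)
      then show "((e + t *\<^sub>R f) \<bullet> y) ^ (2 * Suc k) = (\<Sum>j\<le>2 * Suc k. (real (2 * Suc k choose j) * t ^ j) *
        ((f \<bullet> y) ^ j * (e \<bullet> y) ^ (2 * Suc k - j)))"
        unfolding \<open>(e + t *\<^sub>R f) \<bullet> y = t * (f \<bullet> y) + e \<bullet> y\<close> binomial_ring
        by (intro sum.cong refl) (simp only: power_mult_distrib mult.assoc)
    qed
    also have "\<dots> = (\<Sum>j\<le>2 * Suc k. (real (2 * Suc k choose j) * t ^ j) * I j)"
      unfolding I_def by (subst Bochner_Integration.integral_sum)
        (auto simp del: sum.atMost_Suc power_Suc binomial_Suc_Suc mult_Suc_right)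
    finally show ?thesis by (simp only: mult_ac)
  qed
  from even_binomial_polynomial_coeff[OF this]
  have "real (2 * Suc k choose 2) * I 2 = c * real (Suc k)" .
  \<comment> \<open>The factor \<open>Suc k\<close> also occurs in the \<open>t\<close>-squared
    coefficient of the right-hand side; cancelling it leaves \<open>2 * k + 1\<close>.\<close>
  moreover have "real (2 * Suc k choose 2) = real (Suc k) * real (2 * k + 1)"
    by (simp add: choose_two field_simps)
  ultimately have "real (2 * k + 1) * I 2 = c"
    by simp
  then show ?thesis
    by (simp add: I_def c_def mult.commute)
qed

text \<open>Insert the factor 1, written as the sum of all squared coordinates of \<open>y\<close>,
  into the moment of order \<open>2 * k\<close>. The direction \<open>e\<close> contributes
  \<open>?c\<close>, and each of the other \<open>DIM('a) - 1\<close> directions contributes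
  \<open>?c / (2 * k + 1)\<close> by the mixed moments.\<close>

lemma integral_inner_power_Suc:
  assumes e: "e \<in> Basis"
  shows "(real DIM('a) + 2 * real k) * (\<integral>y. (e \<bullet> y) ^ (2 * Suc k) \<partial>M)
    = real (2 * k + 1) * (\<integral>y. (e \<bullet> y) ^ (2 * k) \<partial>M)"
proof -
  let ?c = "\<integral>y. (e \<bullet> y) ^ (2 * Suc k) \<partial>M"
  have int: "integrable M (\<lambda>y. (e \<bullet> y) ^ i * (f \<bullet> y)\<^sup>2)" for i f
    by (intro integrable_continuous continuous_intros)
  have meas: "(\<lambda>y. (e \<bullet> y) ^ i * (f \<bullet> y)\<^sup>2) \<in> borel_measurable M" for i f
    using int by auto
  have "(\<integral>y. (e \<bullet> y) ^ (2 * k) \<partial>M) = (\<integral>y. (\<Sum>f\<in>Basis. (e \<bullet> y) ^ (2 * k) * (f \<bullet> y)\<^sup>2) \<partial>M)"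
  proof (rule integral_cong_AE)
    show "AE y in M. (e \<bullet> y) ^ (2 * k) = (\<Sum>f\<in>Basis. (e \<bullet> y) ^ (2 * k) * (f \<bullet> y)\<^sup>2)"
      using AE_norm
    proof eventually_elim
      case (elim y)
      then have "y \<bullet> y = 1" by (simp add: norm_eq_1)
      then have "(\<Sum>f\<in>Basis. (f \<bullet> y)\<^sup>2) = 1"
        by (subst (asm) euclidean_inner) (simp add: power2_eq_square inner_commute)
      then show ?case by (simp add: sum_distrib_left[symmetric])
    qed
    show "(\<lambda>y. \<Sum>f\<in>Basis. (e \<bullet> y) ^ (2 * k) * (f \<bullet> y)\<^sup>2) \<in> borel_measurable M"
      by (rule borel_measurable_sum) (rule meas)
  qed simp
  also have "\<dots> = (\<Sum>f\<in>Basis. \<integral>y. (e \<bullet> y) ^ (2 * k) * (f \<bullet> y)\<^sup>2 \<partial>M)"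
    by (rule Bochner_Integration.integral_sum[OF int])
  also have "\<dots> = (\<integral>y. (e \<bullet> y) ^ (2 * k) * (e \<bullet> y)\<^sup>2 \<partial>M)
      + (\<Sum>f\<in>Basis - {e}. \<integral>y. (e \<bullet> y) ^ (2 * k) * (f \<bullet> y)\<^sup>2 \<partial>M)"
    by (rule sum.remove) (use e in auto)
  also have "(\<Sum>f\<in>Basis - {e}. \<integral>y. (e \<bullet> y) ^ (2 * k) * (f \<bullet> y)\<^sup>2 \<partial>M)
      = (\<Sum>f\<in>Basis - {e}. ?c / real (2 * k + 1))"
  proof (rule sum.cong[OF refl])
    fix f assume "f \<in> Basis - {e}"
    then have "norm f = 1" "e \<bullet> f = 0" using e by (auto simp: inner_Basis)
    from integral_inner_mixed_power[OF norm_Basis[OF e] this, of k]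
    show "(\<integral>y. (e \<bullet> y) ^ (2 * k) * (f \<bullet> y)\<^sup>2 \<partial>M) = ?c / real (2 * k + 1)"
      by (simp only: field_simps)
  qed
  also have "(\<integral>y. (e \<bullet> y) ^ (2 * k) * (e \<bullet> y)\<^sup>2 \<partial>M) = ?c"
    by (simp only: power_add[symmetric]) simp
  finally have "(\<integral>y. (e \<bullet> y) ^ (2 * k) \<partial>M) = ?c + (real DIM('a) - 1) * (?c / real (2 * k + 1))"
    using e by (simp add: of_nat_diff DIM_positive Suc_leI del: of_nat_Suc)
  then show ?thesis by (simp add: field_simps)
qed

text \<open>Odd moments vanish by symmetry. For even ones the recursion supplies one further factor
  of the two products in \<open>b_real\<close> at each step, starting from total mass 1.\<close>

lemma integral_inner_power:
  "(\<integral>y. (x \<bullet> y) ^ m \<partial>M) = b_real DIM('a) m * norm x ^ m"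
proof (cases "odd m")
  case True
  then show ?thesis by (simp add: integral_inner_power_odd b_real_def)
next
  case False
  then obtain k where m: "m = 2 * k" by (auto elim: evenE)
  obtain e :: 'a where e: "e \<in> Basis" using nonempty_Basis by blast
  have "(\<integral>y. (e \<bullet> y) ^ (2 * k) \<partial>M) = b_real DIM('a) (2 * k)"
  proof (induction k)
    case 0
    then show ?case by (simp add: b_real_def prob_space)
  next
    case (Suc k)
    have pos: "real DIM('a) + 2 * real k > 0"
      using DIM_positive[where 'a='a] by (simp add: add_pos_nonneg)
    have "b_real DIM('a) (2 * Suc k) = b_real DIM('a) (2 * k) * real (2 * k + 1) / (real DIM('a) + 2 * real k)"
      by (simp add: b_real_def)
    then have "(real DIM('a) + 2 * real k) * b_real DIM('a) (2 * Suc k)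
        = (real DIM('a) + 2 * real k) * (\<integral>y. (e \<bullet> y) ^ (2 * Suc k) \<partial>M)"
      unfolding integral_inner_power_Suc[OF e] Suc.IH using pos by (simp del: of_nat_Suc)
    with pos show ?case
      by (metis less_irrefl mult_left_cancel)
  qed
  then show ?thesis
    using integral_inner_power_scale[of e x m] e m by (simp add: norm_Basis)
qed

text \<open>Each squared norm expands into \<open>A i \<bullet> A i\<close>, a cross term and
  \<open>J i \<bullet> J i\<close>. The constant-mean hypothesis evaluates the sums of
  \<open>A i \<bullet> J i\<close> and \<open>J i \<bullet> J i\<close> as \<open>b * W\<close> and
  \<open>b\<close>, which completes the square.\<close>

lemma gram_sum_minus_mean:
  fixes \<phi> :: "'i \<Rightarrow> 'a \<Rightarrow> 'b::euclidean_space" and v :: "nat \<Rightarrow> 'a"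
  assumes cont: "\<And>i. i \<in> I \<Longrightarrow> continuous_on UNIV (\<phi> i)"
    and K: "\<And>x y. K x y = (\<Sum>i\<in>I. \<phi> i x \<bullet> \<phi> i y)"
    and mean: "\<And>x. (\<integral>y. K x y \<partial>M) = b * norm x ^ m"
  shows "(\<Sum>j<n. \<Sum>k<n. K (v j) (v k)) - b * (\<Sum>l<n. norm (v l) ^ m)\<^sup>2
    = (\<Sum>i\<in>I. (norm ((\<Sum>j<n. \<phi> i (v j)) - (\<Sum>l<n. norm (v l) ^ m) *\<^sub>R (\<integral>y. \<phi> i y \<partial>M)))\<^sup>2)"
proof -
  define W where "W = (\<Sum>l<n. norm (v l) ^ m)"
  define A where "A i = (\<Sum>j<n. \<phi> i (v j))" for i
  define J where "J i = (\<integral>y. \<phi> i y \<partial>M)" for i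
  have int: "integrable M (\<phi> i)" if "i \<in> I" for i
    by (rule integrable_continuous[OF cont[OF that]])
  have KJ: "(\<Sum>i\<in>I. \<phi> i x \<bullet> J i) = b * norm x ^ m" for x
  proof -
    have "b * norm x ^ m = (\<Sum>i\<in>I. \<integral>y. \<phi> i x \<bullet> \<phi> i y \<partial>M)"
      unfolding mean[symmetric] K
      by (rule Bochner_Integration.integral_sum) (use int in auto)
    also have "\<dots> = (\<Sum>i\<in>I. \<phi> i x \<bullet> J i)"
      using int by (intro sum.cong refl) (simp add: J_def)
    finally show ?thesis by simp
  qed
  have AA: "(\<Sum>i\<in>I. A i \<bullet> A i) = (\<Sum>j<n. \<Sum>k<n. K (v j) (v k))"
    unfolding A_def K inner_sum_left inner_sum_right
    by (subst sum.swap, rule sum.cong[OF refl], subst sum.swap) (simp add: inner_commute)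
  have AJ: "(\<Sum>i\<in>I. A i \<bullet> J i) = b * W"
    unfolding A_def inner_sum_left W_def sum_distrib_left
    by (subst sum.swap) (simp add: KJ)
  \<comment> \<open>Integrate \<open>KJ\<close> once more, now in \<open>x\<close>: almost
    everywhere \<open>norm x = 1\<close>, and the total mass is 1.\<close>
  have JJ: "(\<Sum>i\<in>I. J i \<bullet> J i) = b"
  proof -
    have "(\<Sum>i\<in>I. J i \<bullet> J i) = (\<Sum>i\<in>I. \<integral>x. \<phi> i x \<bullet> J i \<partial>M)"
      using int by (intro sum.cong refl) (simp add: J_def)
    also have "\<dots> = (\<integral>x. (\<Sum>i\<in>I. \<phi> i x \<bullet> J i) \<partial>M)"
      by (rule Bochner_Integration.integral_sum[symmetric]) (use int in auto)
    also have "\<dots> = (\<integral>x. b \<partial>M)"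
    proof (rule integral_cong_AE)
      show "AE x in M. (\<Sum>i\<in>I. \<phi> i x \<bullet> J i) = b"
        unfolding KJ using AE_norm by eventually_elim simp
    qed (unfold KJ, auto)
    finally show ?thesis by (simp add: prob_space)
  qed
  have "(\<Sum>i\<in>I. (norm (A i - W *\<^sub>R J i))\<^sup>2)
      = (\<Sum>i\<in>I. A i \<bullet> A i) - 2 * W * (\<Sum>i\<in>I. A i \<bullet> J i) + W\<^sup>2 * (\<Sum>i\<in>I. J i \<bullet> J i)"
    unfolding power2_norm_eq_inner sum_distrib_left sum.distrib[symmetric] sum_subtractf[symmetric]
    by (intro sum.cong refl) (simp add: inner_diff inner_commute power2_eq_square algebra_simps)
  then show ?thesis
    unfolding AA AJ JJ by (simp add: A_def W_def J_def power2_eq_square algebra_simps)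
qed

end

section \<open>Moments of the Hermitian inner product on the sphere\<close>

interpretation sphere: rotation_invariant "sphere_measure :: (complex^'d::finite) measure"
  by (rule rotation_invariant_sphere_measure)

lemma inner_eq_Re_cinner: "x \<bullet> y = Re (cinner x y)"
  by (simp add: inner_vec_def cinner_def inner_complex_def)

lemma cnj_cinner: "cnj (cinner x y) = cinner y x"
  by (simp add: cinner_def mult.commute)

lemma continuous_on_cinner [continuous_intros]: "continuous_on S (\<lambda>y. cinner x y)"
  unfolding cinner_def by (intro continuous_intros)

lemma orthogonal_transformation_phase:
  assumes "norm l = 1"
  shows "orthogonal_transformation (\<lambda>z::complex^'d. \<chi> i. l * z $ i)"
  unfolding orthogonal_transformation
proof
  show "linear (\<lambda>z::complex^'d. \<chi> i. l * z $ i)"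
    by (rule linearI) (auto simp: vec_eq_iff algebra_simps)
qed (simp add: norm_vec_def norm_mult assms)

text \<open>Multiplying \<open>y\<close> by a unimodular \<open>?l\<close> preserves the measure and
  scales the integrand by \<open>cnj ?l ^ p * ?l ^ q\<close>. For a suitable phase this factor is
  -1, so the integral equals its own negative.\<close>

lemma integral_cinner_power_neq:
  fixes x :: "complex^'d"
  assumes "p \<noteq> q"
  shows "(\<integral>y. cinner x y ^ p * cnj (cinner x y) ^ q \<partial>sphere_measure) = 0"
proof -
  \<comment> \<open>The angle solves \<open>(p - q) * t = pi\<close>, which makes the scaling factor
    \<open>cis (- pi)\<close>.\<close>
  define t where "t = pi / (real p - real q)"
  let ?l = "cis t"
  let ?f = "\<lambda>y. cinner x y ^ p * cnj (cinner x y) ^ q"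
  have "cnj ?l ^ p * ?l ^ q = cis (real q * t - real p * t)"
    by (simp add: cis_cnj Complex.DeMoivre cis_mult)
  also have "real q * t - real p * t = - pi"
  proof -
    have "(real p - real q) * t = pi"
      using assms by (simp add: t_def)
    then show ?thesis by (simp add: left_diff_distrib)
  qed
  finally have l: "cnj ?l ^ p * ?l ^ q = -1"
    by (simp add: cis_cnj[symmetric])
  have "(\<integral>y. ?f y \<partial>sphere_measure) = (\<integral>y. ?f (\<chi> i. ?l * y $ i) \<partial>sphere_measure)"
    by (rule sphere.integral_rotate[symmetric])
      (auto intro!: continuous_intros orthogonal_transformation_phase)
  also have "\<dots> = (\<integral>y. (cnj ?l ^ p * ?l ^ q) * ?f y \<partial>sphere_measure)"
  proof (rule Bochner_Integration.integral_cong[OF refl])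
    fix y :: "complex^'d"
    have "cinner x (\<chi> i. ?l * y $ i) = cnj ?l * cinner x y"
      by (simp add: cinner_def sum_distrib_left mult_ac)
    then show "?f (\<chi> i. ?l * y $ i) = (cnj ?l ^ p * ?l ^ q) * ?f y"
      by (simp add: power_mult_distrib mult_ac)
  qed
  also have "\<dots> = - (\<integral>y. ?f y \<partial>sphere_measure)"
    unfolding l by simp
  finally show ?thesis by simp
qed

text \<open>Both sides equal \<open>(2p)! (d-1)! / (p! (d-1+p)!)\<close>. The induction proves the
  version with cleared denominators; \<open>d > 0\<close> makes the truncated \<open>d - 1\<close>
  behave as true subtraction.\<close>

lemma b_real_even_eq_b_pq:
  assumes "d > 0"
  shows "4 ^ p * b_real (2 * d) (2 * p) = real (2 * p choose p) * b_pq d p p"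
proof -
  have *: "b_real (2 * d) (2 * p) * 4 ^ p * fact p * fact (d - 1 + p) = fact (2 * p) * fact (d - 1)"
  proof (induction p)
    case (Suc p)
    have "b_real (2 * d) (2 * Suc p)
        = b_real (2 * d) (2 * p) * real (2 * p + 1) / (2 * (real d + real p))"
      by (simp add: b_real_def algebra_simps)
    then have b: "2 * (real d + real p) * b_real (2 * d) (2 * Suc p)
        = b_real (2 * d) (2 * p) * real (2 * p + 1)"
      using assms by simp
    have f1: "fact (d - 1 + Suc p) = (real d + real p) * fact (d - 1 + p)"
      using assms by (cases d) (simp_all add: algebra_simps)
    have f2: "fact (2 * Suc p) = 2 * real (Suc p) * real (2 * p + 1) * fact (2 * p)"
      by (simp add: algebra_simps)
    have "b_real (2 * d) (2 * Suc p) * 4 ^ Suc p * fact (Suc p) * fact (d - 1 + Suc p)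
        = (2 * (real d + real p) * b_real (2 * d) (2 * Suc p)) * (2 * real (Suc p))
          * 4 ^ p * fact p * fact (d - 1 + p)"
      unfolding f1 by (simp add: algebra_simps)
    also have "\<dots> = 2 * real (Suc p) * real (2 * p + 1)
        * (b_real (2 * d) (2 * p) * 4 ^ p * fact p * fact (d - 1 + p))"
      unfolding b by (simp only: mult_ac)
    also have "\<dots> = fact (2 * Suc p) * fact (d - 1)"
      unfolding Suc.IH f2 by (simp only: mult_ac)
    finally show ?case .
  qed (simp add: b_real_def)
  then have "4 ^ p * b_real (2 * d) (2 * p) = fact (2 * p) * fact (d - 1) / (fact p * fact (d - 1 + p))"
    by (simp add: eq_divide_eq mult_ac)
  moreover have "real (2 * p choose p) = fact (2 * p) / (fact p * fact p)"
    by (simp add: binomial_fact)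
  ultimately show ?thesis
    by (simp add: b_pq_def)
qed

text \<open>For \<open>p = q\<close> the moment is read off from the real one: in the binomial expansion of
  \<open>(2 Re \<langle>x,y\<rangle>)\<^sup>2\<^sup>p\<close> only the middle term has nonzero integral.\<close>

lemma integral_cinner_power:
  fixes x :: "complex^'d"
  shows "(\<integral>y. cinner x y ^ p * cnj (cinner x y) ^ q \<partial>sphere_measure)
    = complex_of_real (b_pq CARD('d) p q * norm x ^ (p + q))"
proof (cases "p = q")
  case False
  then show ?thesis by (simp add: integral_cinner_power_neq b_pq_def)
next
  case True
  define I where "I j = (\<integral>y. cinner x y ^ j * cnj (cinner x y) ^ (2 * p - j) \<partial>sphere_measure)" for j
  have int [simp]: "integrable sphere_measure (\<lambda>y. cinner x y ^ j * cnj (cinner x y) ^ i)" for i j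
    by (intro sphere.integrable_continuous continuous_intros)
  have "complex_of_real (4 ^ p * (\<integral>y. (x \<bullet> y) ^ (2 * p) \<partial>sphere_measure))
      = (\<integral>y. of_real (4 ^ p * (x \<bullet> y) ^ (2 * p)) \<partial>sphere_measure)"
    by (simp only: integral_complex_of_real integral_mult_right_zero)
  also have "\<dots> = (\<integral>y. (\<Sum>j\<le>2 * p. of_nat (2 * p choose j) *
      (cinner x y ^ j * cnj (cinner x y) ^ (2 * p - j))) \<partial>sphere_measure)"
  proof (rule Bochner_Integration.integral_cong[OF refl])
    fix y
    have "complex_of_real (4 ^ p * (x \<bullet> y) ^ (2 * p)) = (of_real (2 * (x \<bullet> y))) ^ (2 * p)"
      by (simp add: power_mult power_mult_distrib)
    also have "complex_of_real (2 * (x \<bullet> y)) = cinner x y + cnj (cinner x y)"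
      by (simp add: inner_eq_Re_cinner complex_add_cnj)
    finally show "complex_of_real (4 ^ p * (x \<bullet> y) ^ (2 * p)) = (\<Sum>j\<le>2 * p. of_nat (2 * p choose j) *
      (cinner x y ^ j * cnj (cinner x y) ^ (2 * p - j)))"
      by (simp only: binomial_ring mult.assoc)
  qed
  also have "\<dots> = (\<Sum>j\<le>2 * p. of_nat (2 * p choose j) * I j)"
    unfolding I_def by (subst Bochner_Integration.integral_sum) auto
  also have "\<dots> = (\<Sum>j\<in>{p}. of_nat (2 * p choose j) * I j)"
  proof (rule sum.mono_neutral_right)
    show "\<forall>j\<in>{..2 * p} - {p}. of_nat (2 * p choose j) * I j = 0"
    proof
      fix j assume "j \<in> {..2 * p} - {p}"
      then have "j \<noteq> 2 * p - j" by auto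
      then show "of_nat (2 * p choose j) * I j = 0"
        unfolding I_def by (simp add: integral_cinner_power_neq)
    qed
  qed auto
  also have "\<dots> = of_nat (2 * p choose p) * I p" by simp
  also have "4 ^ p * (\<integral>y. (x \<bullet> y) ^ (2 * p) \<partial>sphere_measure)
      = 4 ^ p * b_real (2 * CARD('d)) (2 * p) * norm x ^ (2 * p)"
    by (simp add: sphere.integral_inner_power mult.commute[of _ 2])
  also have "\<dots> = real (2 * p choose p) * (b_pq CARD('d) p p * norm x ^ (2 * p))"
    by (simp only: b_real_even_eq_b_pq[OF zero_less_card_finite] mult.assoc)
  finally have "of_nat (2 * p choose p) * I p
      = of_nat (2 * p choose p) * complex_of_real (b_pq CARD('d) p p * norm x ^ (2 * p))"
    by simp
  then have "I p = complex_of_real (b_pq CARD('d) p p * norm x ^ (2 * p))"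
    by simp
  then show ?thesis
    by (simp add: I_def True mult_2 del: of_real_mult)
qed

subsection \<open>Monomials as tensors\<close>

text \<open>Expand the product by choosing one summand from each factor. Summing over words instead
  of multi-indices keeps multinomial coefficients out, so the kernels become plain sums of
  products.\<close>

lemma power_sum_eq_sum_lists:
  fixes f :: "'i::finite \<Rightarrow> 'a::comm_semiring_1"
  shows "(\<Sum>i\<in>UNIV. f i) ^ p = (\<Sum>xs | length xs = p. prod_list (map f xs))"
proof (induction p)
  case (Suc p)
  have "(\<Sum>xs | length xs = Suc p. prod_list (map f xs))
      = (\<Sum>(i, xs)\<in>UNIV \<times> {xs. length xs = p}. f i * prod_list (map f xs))"
    by (rule sum.reindex_bij_witness[of _ "\<lambda>(i, xs). i # xs" "\<lambda>xs. (hd xs, tl xs)"])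
      (auto simp: length_Suc_conv)
  also have "\<dots> = (\<Sum>i\<in>UNIV. f i) * (\<Sum>xs | length xs = p. prod_list (map f xs))"
    by (simp add: sum_product sum.cartesian_product)
  finally show ?case by (simp add: Suc.IH)
qed simp

lemma prod_list_map_eq_prod_count_list:
  fixes f :: "'i::finite \<Rightarrow> 'a::comm_semiring_1"
  shows "prod_list (map f xs) = (\<Prod>i\<in>UNIV. f i ^ count_list xs i)"
proof (induction xs)
  case (Cons x xs)
  have "(\<Prod>i\<in>UNIV. f i ^ count_list (x # xs) i)
      = (\<Prod>i\<in>UNIV. (if i = x then f i else 1) * f i ^ count_list xs i)"
    by (rule prod.cong) auto
  then show ?case by (simp add: prod.distrib Cons.IH)
qed simp

text \<open>Every multi-index is the letter count of some word, since on a finite alphabet any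
  function to \<open>nat\<close> is a multiset. This yields the spanning property of the word
  monomials.\<close>

lemma count_list_surj:
  fixes a :: "'i::finite \<Rightarrow> nat"
  obtains xs where "count_list xs = a"
proof -
  obtain xs where "mset xs = Abs_multiset a" using ex_mset by blast
  then have "count (mset xs) = a" by (simp add: Abs_multiset_inverse)
  then have "count_list xs = a" by (simp add: fun_eq_iff count_mset)
  then show ?thesis using that by blast
qed

lemma length_eq_sum_count_list:
  fixes xs :: "'i::finite list"
  shows "sum (count_list xs) UNIV = length xs"
  by (rule sum_count_set) auto

lemma finite_lists_length: "finite {xs :: 'i::finite list. length xs = p}"
  using finite_lists_length_eq[of "UNIV :: 'i set" p] by simp

lemma finite_fun_sum_le: "finite {a :: 'i::finite \<Rightarrow> nat. sum a UNIV \<le> p}"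
proof (rule finite_subset)
  show "{a :: 'i \<Rightarrow> nat. sum a UNIV \<le> p} \<subseteq> (\<Pi>\<^sub>E i\<in>UNIV. {..p})"
    by (auto intro: order_trans[OF member_le_sum[of _ UNIV]])
qed (intro finite_PiE; simp)

text \<open>Homogeneity turns the weighted quadrature of \<open>\<phi> i\<close> into the sum of the
  \<open>\<phi> i (v j)\<close> divided by \<open>W\<close>. Each square in the Gram identity is
  therefore a scaled quadrature error, and all of them vanish exactly when the rule is exact on the
  spanning family, hence on \<open>P\<close>.\<close>

lemma gram_sum_ge_and_eq_iff_design:
  fixes v :: "nat \<Rightarrow> complex^'d"
    and \<phi> :: "'i \<Rightarrow> complex^'d \<Rightarrow> 'b::{real_normed_field,euclidean_space}"
  assumes fin: "finite I"
    and cont: "\<And>i. i \<in> I \<Longrightarrow> continuous_on UNIV (\<phi> i)"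
    and hom: "\<And>i r x. i \<in> I \<Longrightarrow> r \<ge> 0 \<Longrightarrow> \<phi> i (r *\<^sub>R x) = r ^ m *\<^sub>R \<phi> i x"
    and K: "\<And>x y. K x y = (\<Sum>i\<in>I. \<phi> i x \<bullet> \<phi> i y)"
    and mean: "\<And>x. (\<integral>y. K x y \<partial>sphere_measure) = b * norm x ^ m"
    and mem: "\<And>i. i \<in> I \<Longrightarrow> \<phi> i \<in> P"
    and span: "\<And>f. f \<in> P \<Longrightarrow> \<exists>(S :: 's set) c g. f = (\<lambda>z. \<Sum>s\<in>S. c s * g s z) \<and> g ` S \<subseteq> \<phi> ` I"
    and nz: "\<exists>j<n. v j \<noteq> 0"
  shows "b * (\<Sum>l<n. norm (v l) ^ m)\<^sup>2 \<le> (\<Sum>j<n. \<Sum>k<n. K (v j) (v k))" (is ?ge)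
    and "(\<Sum>j<n. \<Sum>k<n. K (v j) (v k)) = b * (\<Sum>l<n. norm (v l) ^ m)\<^sup>2
      \<longleftrightarrow> weighted_design m n v P" (is ?iff)
proof -
  define W where "W = (\<Sum>l<n. norm (v l) ^ m)"
  obtain j0 where "j0 < n" "v j0 \<noteq> 0" using nz by blast
  then have W: "W > 0"
    unfolding W_def by (intro sum_pos2[of _ j0]) auto
  define Q where "Q f = (\<Sum>j<n. (norm (v j) ^ m / W) *\<^sub>R f (v j /\<^sub>R norm (v j)))"
    for f :: "complex^'d \<Rightarrow> 'b"
  define E where "E i = (\<Sum>j<n. \<phi> i (v j)) - W *\<^sub>R (\<integral>y. \<phi> i y \<partial>sphere_measure)" for i
  have design: "weighted_design m n v P \<longleftrightarrow> (\<forall>f\<in>P. integral\<^sup>L sphere_measure f = Q f)"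
    by (simp add: weighted_design_def Q_def W_def)
  have int: "integrable sphere_measure (\<phi> i)" if "i \<in> I" for i
    by (rule sphere.integrable_continuous[OF cont[OF that]])
  have Q\<phi>: "Q (\<phi> i) = (\<Sum>j<n. \<phi> i (v j)) /\<^sub>R W" if "i \<in> I" for i
  proof -
    have "norm (v j) ^ m *\<^sub>R \<phi> i (v j /\<^sub>R norm (v j)) = \<phi> i (v j)" for j
    proof -
      have "norm (v j) ^ m *\<^sub>R \<phi> i (v j /\<^sub>R norm (v j)) = \<phi> i (norm (v j) *\<^sub>R (v j /\<^sub>R norm (v j)))"
        by (rule hom[OF that, symmetric]) simp
      \<comment> \<open>At \<open>v j = 0\<close> the quotient is 0 because
        \<open>inverse 0 = 0\<close>, so zero vectors obey the same identity.\<close>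
      also have "norm (v j) *\<^sub>R (v j /\<^sub>R norm (v j)) = v j"
        by (cases "v j = 0") simp_all
      finally show ?thesis .
    qed
    then have "(norm (v j) ^ m / W) *\<^sub>R \<phi> i (v j /\<^sub>R norm (v j)) = \<phi> i (v j) /\<^sub>R W" for j
      by (metis divide_inverse mult.commute scaleR_scaleR)
    then show ?thesis by (simp add: Q_def scaleR_sum_right)
  qed
  have E0: "E i = 0 \<longleftrightarrow> (\<integral>y. \<phi> i y \<partial>sphere_measure) = Q (\<phi> i)" if "i \<in> I" for i
    unfolding Q\<phi>[OF that] E_def using W by (auto simp: field_simps)
  have gram: "(\<Sum>j<n. \<Sum>k<n. K (v j) (v k)) - b * W\<^sup>2 = (\<Sum>i\<in>I. (norm (E i))\<^sup>2)"
    using sphere.gram_sum_minus_mean[OF cont K mean] by (simp add: E_def W_def)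
  have "(\<Sum>i\<in>I. (norm (E i))\<^sup>2) \<ge> 0" by (rule sum_nonneg) simp
  with gram show ?ge by (simp add: W_def)
  have "(\<Sum>i\<in>I. (norm (E i))\<^sup>2) = 0 \<longleftrightarrow> (\<forall>i\<in>I. (\<integral>y. \<phi> i y \<partial>sphere_measure) = Q (\<phi> i))"
    by (simp add: sum_nonneg_eq_0_iff fin E0)
  also have "\<dots> \<longleftrightarrow> weighted_design m n v P"
    unfolding design
  proof (intro iffI ballI)
    \<comment> \<open>The integral and the quadrature \<open>Q\<close> are both linear, so exactness
      passes from the generators to their combinations.\<close>
    fix f assume *: "\<forall>i\<in>I. (\<integral>y. \<phi> i y \<partial>sphere_measure) = Q (\<phi> i)" and "f \<in> P"
    from span[OF this(2)] obtain S :: "'s set" and c g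
      where f: "f = (\<lambda>z. \<Sum>s\<in>S. c s * g s z)" and g: "g ` S \<subseteq> \<phi> ` I"
      by blast
    have gs: "integrable sphere_measure (g s)" "integral\<^sup>L sphere_measure (g s) = Q (g s)"
      if "s \<in> S" for s
      using g int * that by auto
    have "integral\<^sup>L sphere_measure f = (\<Sum>s\<in>S. c s * integral\<^sup>L sphere_measure (g s))"
      unfolding f by (subst Bochner_Integration.integral_sum) (use gs in auto)
    also have "\<dots> = (\<Sum>s\<in>S. c s * Q (g s))"
      using gs by simp
    also have "\<dots> = Q f"
      unfolding Q_def f sum_distrib_left scaleR_sum_right
      by (subst sum.swap) simp
    finally show "integral\<^sup>L sphere_measure f = Q f" .
  qed (use mem in auto)
  finally show ?iff
    unfolding W_def[symmetric] gram[symmetric] by simp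
qed

text \<open>These are the coordinates of the tensor product of \<open>p\<close> copies of
  \<open>z\<close> and \<open>q\<close> copies of its conjugate, for words of lengths
  \<open>p\<close> and \<open>q\<close>. Permuted words give the same function.\<close>

definition tensor_pq :: "'d list \<times> 'd list \<Rightarrow> complex^'d::finite \<Rightarrow> complex" where
  "tensor_pq = (\<lambda>(xs, ys) z. prod_list (map (\<lambda>i. z $ i) xs) * prod_list (map (\<lambda>i. cnj (z $ i)) ys))"

definition tensor_real :: "('d \<times> bool) list \<Rightarrow> complex^'d::finite \<Rightarrow> real" where
  "tensor_real xs z = prod_list (map (\<lambda>k. z \<bullet> real_axis k) xs)"

lemma tensor_pq_eq_monomial:
  "tensor_pq (xs, ys) z = (\<Prod>i\<in>UNIV. (z $ i) ^ count_list xs i * (cnj (z $ i)) ^ count_list ys i)"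
  by (simp add: tensor_pq_def prod_list_map_eq_prod_count_list prod.distrib)

lemma tensor_real_eq_monomial:
  "tensor_real xs z
    = (\<Prod>i\<in>UNIV. Re (z $ i) ^ count_list xs (i, True) * Im (z $ i) ^ count_list xs (i, False))"
proof -
  let ?f = "\<lambda>k. (z \<bullet> real_axis k) ^ count_list xs k"
  have "tensor_real xs z = (\<Prod>k\<in>UNIV \<times> UNIV. ?f k)"
    by (simp add: tensor_real_def prod_list_map_eq_prod_count_list)
  also have "\<dots> = (\<Prod>i\<in>UNIV. \<Prod>b\<in>UNIV. ?f (i, b))"
    by (simp only: prod.cartesian_product split_def prod.collapse)
  finally show ?thesis
    by (simp add: UNIV_bool inner_real_axis mult.commute)
qed

lemma prod_list_map_mult:
  fixes f g :: "'i \<Rightarrow> 'a::comm_monoid_mult"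
  shows "prod_list (map (\<lambda>i. f i * g i) xs) = prod_list (map f xs) * prod_list (map g xs)"
  by (induction xs) (auto simp: mult_ac)

lemma prod_list_map_scaleR:
  fixes f :: "'i \<Rightarrow> 'a::real_algebra_1"
  shows "prod_list (map (\<lambda>i. r *\<^sub>R f i) xs) = r ^ length xs *\<^sub>R prod_list (map f xs)"
  by (induction xs) auto

lemma cnj_prod_list_map: "cnj (prod_list (map f xs)) = prod_list (map (\<lambda>i. cnj (f i)) xs)"
  by (induction xs) auto

text \<open>Expand both powers over words; the product of one term from each separates into a factor
  in \<open>x\<close> and a conjugated factor in \<open>y\<close>.\<close>

lemma cinner_power_eq_sum_tensor:
  "cinner x y ^ p * cnj (cinner x y) ^ q
    = (\<Sum>k\<in>{xs. length xs = p} \<times> {ys. length ys = q}. tensor_pq k x * cnj (tensor_pq k y))"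
proof -
  have "cinner x y ^ p * cnj (cinner x y) ^ q
    = (\<Sum>i\<in>UNIV. x $ i * cnj (y $ i)) ^ p * (\<Sum>i\<in>UNIV. cnj (x $ i) * y $ i) ^ q"
    by (simp add: cinner_def)
  also have "\<dots> = (\<Sum>(xs, ys)\<in>{xs. length xs = p} \<times> {ys. length ys = q}.
      tensor_pq (xs, ys) x * cnj (tensor_pq (xs, ys) y))"
    unfolding power_sum_eq_sum_lists sum_product sum.cartesian_product
    by (intro sum.cong refl) (auto simp: tensor_pq_def prod_list_map_mult cnj_prod_list_map mult_ac)
  finally show ?thesis by (simp add: split_def)
qed

lemma inner_power_eq_sum_tensor:
  "(x \<bullet> y) ^ m = (\<Sum>xs | length xs = m. tensor_real xs x * tensor_real xs y)"
proof -
  have "x \<bullet> y = (\<Sum>k\<in>UNIV. (x \<bullet> real_axis k) * (y \<bullet> real_axis k))"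
    by (subst euclidean_inner) (rule sum.reindex_bij_betw[OF bij_betw_real_axis, symmetric])
  then show ?thesis
    by (simp add: power_sum_eq_sum_lists tensor_real_def prod_list_map_mult)
qed

lemma continuous_on_tensor_pq: "continuous_on S (tensor_pq k)"
  by (cases k) (simp add: tensor_pq_eq_monomial[abs_def] continuous_intros)

lemma continuous_on_tensor_real: "continuous_on S (tensor_real xs)"
  by (simp add: tensor_real_eq_monomial[abs_def] continuous_intros)

lemma tensor_pq_scaleR:
  "tensor_pq (xs, ys) (r *\<^sub>R z) = r ^ (length xs + length ys) *\<^sub>R tensor_pq (xs, ys) z"
proof -
  have "prod_list (map (($) (r *\<^sub>R z)) xs) = r ^ length xs *\<^sub>R prod_list (map (($) z) xs)"
    by (induction xs) auto
  then show ?thesis by (simp add: tensor_pq_def prod_list_map_scaleR power_add)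
qed

lemma tensor_real_scaleR: "tensor_real xs (r *\<^sub>R z) = r ^ length xs *\<^sub>R tensor_real xs z"
  unfolding tensor_real_def by (induction xs) auto

lemma tensor_pq_in_hom_pq:
  "tensor_pq (xs, ys) \<in> (hom_pq (length xs) (length ys) :: ((complex^'d::finite) \<Rightarrow> complex) set)"
proof -
  let ?S = "{(a, b). sum a UNIV = length xs \<and> sum b UNIV = length ys} :: (('d \<Rightarrow> nat) \<times> ('d \<Rightarrow> nat)) set"
  \<comment> \<open>The coefficients select the single monomial whose exponents are the letter
    counts of the two words.\<close>
  let ?c = "\<lambda>a b. if (a, b) = (count_list xs, count_list ys) then 1 else 0 :: complex"
  let ?g = "\<lambda>z. \<lambda>(a, b). \<Prod>i\<in>UNIV. (z $ i :: complex) ^ a i * (cnj (z $ i)) ^ b i"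
  have fin: "finite ?S"
    by (rule finite_subset[OF _ finite_cartesian_product[OF
      finite_fun_sum_le[of "length xs"] finite_fun_sum_le[of "length ys"]]]) auto
  have "tensor_pq (xs, ys) z = (\<Sum>(a, b)\<in>?S. ?c a b * ?g z (a, b))" for z :: "complex^'d"
  proof -
    have "(\<Sum>(a, b)\<in>?S. ?c a b * ?g z (a, b))
        = (\<Sum>k\<in>?S. if k = (count_list xs, count_list ys) then ?g z k else 0)"
      by (intro sum.cong refl) (auto split: if_splits)
    also have "\<dots> = ?g z (count_list xs, count_list ys)"
      using fin by (simp add: length_eq_sum_count_list)
    finally show ?thesis by (simp add: tensor_pq_eq_monomial)
  qed
  then show ?thesis
    unfolding hom_pq_def by (intro CollectI exI[of _ ?c]) (simp add: fun_eq_iff)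
qed

lemma tensor_real_in_hom_real:
  "tensor_real xs \<in> (hom_real (length xs) :: ((complex^'d::finite) \<Rightarrow> real) set)"
proof -
  let ?S = "{(a, b). sum a UNIV + sum b UNIV = length xs} :: (('d \<Rightarrow> nat) \<times> ('d \<Rightarrow> nat)) set"
  let ?k = "(\<lambda>i. count_list xs (i, True), \<lambda>i. count_list xs (i, False))"
  let ?c = "\<lambda>a b. if (a, b) = ?k then 1 else 0 :: real"
  let ?g = "\<lambda>z. \<lambda>(a, b). \<Prod>i\<in>UNIV. (Re (z $ i)) ^ a i * (Im (z $ i)) ^ b i"
  have fin: "finite ?S"
    by (rule finite_subset[OF _ finite_cartesian_product[OF
      finite_fun_sum_le[of "length xs"] finite_fun_sum_le[of "length xs"]]]) auto
  have "length xs = (\<Sum>k\<in>UNIV \<times> UNIV. count_list xs k)"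
    by (simp add: length_eq_sum_count_list)
  also have "\<dots> = (\<Sum>i\<in>UNIV. \<Sum>b\<in>UNIV. count_list xs (i, b))"
    by (simp only: sum.cartesian_product split_def prod.collapse)
  finally have k: "?k \<in> ?S"
    by (simp add: UNIV_bool sum.distrib add.commute)
  have "tensor_real xs z = (\<Sum>(a, b)\<in>?S. ?c a b * ?g z (a, b))" for z :: "complex^'d"
  proof -
    have "(\<Sum>(a, b)\<in>?S. ?c a b * ?g z (a, b)) = (\<Sum>k\<in>?S. if k = ?k then ?g z k else 0)"
      by (intro sum.cong refl) (auto split: if_splits)
    also have "\<dots> = ?g z ?k"
      using fin k by (simp only: sum.delta if_True)
    finally show ?thesis by (simp add: tensor_real_eq_monomial)
  qed
  then show ?thesis
    unfolding hom_real_def by (intro CollectI exI[of _ ?c]) (simp add: fun_eq_iff)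
qed

lemma hom_pq_span_tensor:
  fixes f :: "complex^'d::finite \<Rightarrow> complex"
  assumes "f \<in> hom_pq p q"
  shows "\<exists>(S :: (('d \<Rightarrow> nat) \<times> ('d \<Rightarrow> nat)) set) c g. f = (\<lambda>z. \<Sum>s\<in>S. c s * g s z)
    \<and> g ` S \<subseteq> tensor_pq ` ({xs. length xs = p} \<times> {ys. length ys = q})"
proof -
  let ?S = "{(a, b). sum a UNIV = p \<and> sum b UNIV = q} :: (('d \<Rightarrow> nat) \<times> ('d \<Rightarrow> nat)) set"
  let ?g = "\<lambda>(a, b) z. \<Prod>i\<in>UNIV. (z $ i :: complex) ^ a i * (cnj (z $ i)) ^ b i"
  obtain c where "f = (\<lambda>z. \<Sum>(a, b)\<in>?S. c a b * (\<Prod>i\<in>UNIV. (z $ i) ^ a i * (cnj (z $ i)) ^ b i))"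
    using assms unfolding hom_pq_def by blast
  then have "f = (\<lambda>z. \<Sum>s\<in>?S. case_prod c s * ?g s z)"
    by (simp add: split_def)
  moreover have "?g ` ?S \<subseteq> tensor_pq ` ({xs. length xs = p} \<times> {ys. length ys = q})"
  proof (rule image_subsetI)
    fix s assume "s \<in> ?S"
    then obtain a b where s: "s = (a, b)" "sum a UNIV = p" "sum b UNIV = q" by auto
    obtain xs ys where c: "count_list xs = a" "count_list ys = b"
      by (meson count_list_surj)
    have "length xs = p" "length ys = q"
      using s by (auto simp: c[symmetric] length_eq_sum_count_list)
    moreover have "?g s = tensor_pq (xs, ys)"
      by (simp add: fun_eq_iff tensor_pq_eq_monomial c s)
    ultimately show "?g s \<in> tensor_pq ` ({xs. length xs = p} \<times> {ys. length ys = q})"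
      by blast
  qed
  ultimately show ?thesis by blast
qed

lemma hom_real_span_tensor:
  fixes f :: "complex^'d::finite \<Rightarrow> real"
  assumes "f \<in> hom_real m"
  shows "\<exists>(S :: (('d \<Rightarrow> nat) \<times> ('d \<Rightarrow> nat)) set) c g. f = (\<lambda>z. \<Sum>s\<in>S. c s * g s z)
    \<and> g ` S \<subseteq> tensor_real ` {xs. length xs = m}"
proof -
  let ?S = "{(a, b). sum a UNIV + sum b UNIV = m} :: (('d \<Rightarrow> nat) \<times> ('d \<Rightarrow> nat)) set"
  let ?g = "\<lambda>(a, b) z. \<Prod>i\<in>UNIV. (Re (z $ i)) ^ a i * (Im (z $ i)) ^ b i"
  obtain c where "f = (\<lambda>z. \<Sum>(a, b)\<in>?S. c a b * (\<Prod>i\<in>UNIV. (Re (z $ i)) ^ a i * (Im (z $ i)) ^ b i))"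
    using assms unfolding hom_real_def by blast
  then have "f = (\<lambda>z. \<Sum>s\<in>?S. case_prod c s * ?g s z)"
    by (simp add: split_def)
  moreover have "?g ` ?S \<subseteq> tensor_real ` {xs. length xs = m}"
  proof (rule image_subsetI)
    fix s assume "s \<in> ?S"
    then obtain a b where s: "s = (a, b)" "sum a UNIV + sum b UNIV = m" by auto
    \<comment> \<open>The exponents of the real and imaginary parts are packed into one multi-index
      on \<open>'d \<times> bool\<close>, which a word then realises.\<close>
    obtain xs where xs: "count_list xs = (\<lambda>(i, t). if t then a i else b i)"
      by (rule count_list_surj)
    have "length xs = (\<Sum>k\<in>UNIV \<times> UNIV. count_list xs k)"
      by (simp add: length_eq_sum_count_list)
    also have "\<dots> = (\<Sum>i\<in>UNIV. \<Sum>t\<in>UNIV. count_list xs (i, t))"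
      by (simp only: sum.cartesian_product split_def prod.collapse)
    also have "\<dots> = m"
      using s by (simp add: xs UNIV_bool sum.distrib)
    finally have "length xs = m" .
    moreover have "?g s = tensor_real xs"
      by (simp add: fun_eq_iff tensor_real_eq_monomial xs s)
    ultimately show "?g s \<in> tensor_real ` {xs. length xs = m}"
      by blast
  qed
  ultimately show ?thesis by blast
qed

text \<open>The first sum is complex-valued, so its inequality is expressed as membership in the
  reals together with a bound on the real part.\<close>

theorem theorem5p9:
  fixes v :: "nat \<Rightarrow> complex^'d" and n p q m :: nat
  assumes "m = p + q" and "m \<ge> 1" and "\<exists>j<n. v j \<noteq> 0"
  shows "(\<Sum>j<n. \<Sum>k<n. cinner (v j) (v k) ^ p * cnj (cinner (v j) (v k)) ^ q) \<in> \<real>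
     \<and> Re (\<Sum>j<n. \<Sum>k<n. cinner (v j) (v k) ^ p * cnj (cinner (v j) (v k)) ^ q)
         \<ge> b_pq CARD('d) p q * (\<Sum>l<n. norm (v l) ^ (p + q))\<^sup>2
     \<and> ((\<Sum>j<n. \<Sum>k<n. cinner (v j) (v k) ^ p * cnj (cinner (v j) (v k)) ^ q)
           = complex_of_real (b_pq CARD('d) p q * (\<Sum>l<n. norm (v l) ^ (p + q))\<^sup>2)
         \<longleftrightarrow> weighted_design m n v (hom_pq p q :: ((complex^'d) \<Rightarrow> complex) set))
     \<and> (\<Sum>j<n. \<Sum>k<n. (Re (cinner (v j) (v k))) ^ m)
         \<ge> b_real (2 * CARD('d)) m * (\<Sum>l<n. norm (v l) ^ m)\<^sup>2
     \<and> ((\<Sum>j<n. \<Sum>k<n. (Re (cinner (v j) (v k))) ^ m)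
           = b_real (2 * CARD('d)) m * (\<Sum>l<n. norm (v l) ^ m)\<^sup>2
         \<longleftrightarrow> weighted_design m n v (hom_real m :: ((complex^'d) \<Rightarrow> real) set))"
proof -
  let ?S = "\<Sum>j<n. \<Sum>k<n. cinner (v j) (v k) ^ p * cnj (cinner (v j) (v k)) ^ q"
  let ?W = "\<Sum>l<n. norm (v l) ^ m"
  let ?K = "\<lambda>x y :: complex^'d. Re (cinner x y ^ p * cnj (cinner x y) ^ q)"
  let ?P = "hom_pq p q :: ((complex^'d) \<Rightarrow> complex) set"
  have m: "p + q = m" using assms(1) by simp
  have ReS: "Re ?S = (\<Sum>j<n. \<Sum>k<n. ?K (v j) (v k))"
    by (simp only: Re_sum)
  \<comment> \<open>Conjugation exchanges the arguments of \<open>cinner\<close>, which amounts to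
    exchanging the two summation indices.\<close>
  have "cnj ?S = ?S"
    by (subst (2) sum.swap) (simp only: cnj_sum complex_cnj_mult complex_cnj_power cnj_cinner)
  then have real: "?S \<in> \<real>"
    by (simp add: Reals_cnj_iff)
  \<comment> \<open>The real part of \<open>a * cnj b\<close> is the Euclidean inner product of
    \<open>a\<close> and \<open>b\<close> in the plane, which gives the form required of a
    kernel.\<close>
  have K: "?K x y = (\<Sum>k\<in>{xs. length xs = p} \<times> {ys. length ys = q}. tensor_pq k x \<bullet> tensor_pq k y)" for x y
    unfolding cinner_power_eq_sum_tensor by (simp add: inner_complex_def)
  have mean: "(\<integral>y. ?K x y \<partial>sphere_measure) = b_pq CARD('d) p q * norm x ^ m" for x
  proof -
    have "integrable sphere_measure (\<lambda>y. cinner x y ^ p * cnj (cinner x y) ^ q)"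
      by (intro sphere.integrable_continuous continuous_intros)
    then show ?thesis
      by (simp only: integral_Re integral_cinner_power m Re_complex_of_real)
  qed
  note complex_case = gram_sum_ge_and_eq_iff_design[where P = ?P and K = ?K and \<phi> = tensor_pq and m = m
      and b = "b_pq CARD('d) p q" and n = n and v = v, OF _ _ _ K mean _ hom_pq_span_tensor assms(3)]
  have ge: "b_pq CARD('d) p q * ?W\<^sup>2 \<le> Re ?S"
    unfolding ReS
    by (rule complex_case(1))
      (use m in \<open>auto simp: finite_lists_length continuous_on_tensor_pq tensor_pq_scaleR tensor_pq_in_hom_pq\<close>)
  have iff: "Re ?S = b_pq CARD('d) p q * ?W\<^sup>2 \<longleftrightarrow> weighted_design m n v ?P"
    unfolding ReS
    by (rule complex_case(2))
      (use m in \<open>auto simp: finite_lists_length continuous_on_tensor_pq tensor_pq_scaleR tensor_pq_in_hom_pq\<close>)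
  have eq: "z = complex_of_real r \<longleftrightarrow> Re z = r" if "z \<in> \<real>" for z r
    using that by (auto simp: complex_is_Real_iff complex_eq_iff)
  have K': "(x \<bullet> y) ^ m = (\<Sum>xs | length xs = m. tensor_real xs x \<bullet> tensor_real xs y)" for x y :: "complex^'d"
    by (simp add: inner_power_eq_sum_tensor)
  have "DIM(complex^'d) = 2 * CARD('d)" by simp
  then have mean': "(\<integral>y. (x \<bullet> y) ^ m \<partial>sphere_measure) = b_real (2 * CARD('d)) m * norm x ^ m"
    for x :: "complex^'d"
    by (simp only: sphere.integral_inner_power)
  note real_case = gram_sum_ge_and_eq_iff_design[where P = "hom_real m" and K = "\<lambda>x y. (x \<bullet> y) ^ m"
      and \<phi> = tensor_real and m = m and b = "b_real (2 * CARD('d)) m" and n = n and v = v,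
      OF finite_lists_length continuous_on_tensor_real _ K' mean' _ hom_real_span_tensor assms(3)]
  have ge': "b_real (2 * CARD('d)) m * ?W\<^sup>2 \<le> (\<Sum>j<n. \<Sum>k<n. (v j \<bullet> v k) ^ m)"
    by (rule real_case(1)) (auto simp: tensor_real_scaleR tensor_real_in_hom_real)
  have iff': "(\<Sum>j<n. \<Sum>k<n. (v j \<bullet> v k) ^ m) = b_real (2 * CARD('d)) m * ?W\<^sup>2
      \<longleftrightarrow> weighted_design m n v (hom_real m :: ((complex^'d) \<Rightarrow> real) set)"
    by (rule real_case(2)) (auto simp: tensor_real_scaleR tensor_real_in_hom_real)
  show ?thesis
    using real ge iff ge' iff' unfolding eq[OF real] m inner_eq_Re_cinner by blast
qed

end
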